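(* Let $\pi$ be the stationary distribution of the Elo process. Then $\operatorname{supp}(\pi)=\mathcal{Z}_N$.
   Context: Notation: $\mathbb{N}=\{0,1,2,\dots\}$; $N\ge 2$ is an integer (number of players); $x^i$ is the $i$-th coordinate of $x$; $e_i$ is the $i$-th canonical vector of $\mathbb{R}^N$; $\mathcal{Z}_N=\{x\in\mathbb{R}^N:\sum_{i=1}^N x^i=0\}$. $\operatorname{supp}$ denotes the (closed, topological) support of a measure. Standing assumptions. (i) $\rho=(\rho^1,\dots,\rho^N)\in\mathcal{Z}_N$ is a fixed vector (true skills). (ii) $b:\mathbb{R}\to(-1,1)$ is odd, strictly increasing and $L$-Lipschitz, and for every $M>0$, $\ell_M:=\inf_{-M\le v<u\le M}\frac{b(u)-b(v)}{u-v}>0$. (iii) For every distinct $i,j\in\{1,\dots,N\}$, $S^{ij}$ is a random variable with values in $[-1,1]$, $\mathbb{E}[S^{ij}]=b(\rho^i-\rho^j)$ and $S^{ji}=-S^{ij}$. (iv) $K>0$ is a constant with $KL<1$. (v) For every distinct $i,j$ and every $\epsilon>0$, $\mathbb{P}(S^{ij}<-1+\epsilon)>0$ and $\mathbb{P}(S^{ij}>1-\epsilon)>0$. Elo process: the Markov chain $(X_t)_{t\in\mathbb{N}}$ on $\mathcal{Z}_N$ started from a random vector $X_0\in\mathcal{Z}_N$ with the following dynamics: at step $t$, an ordered pair $(I_t,J_t)$ of distinct indices in $\{1,\dots,N\}$ is chosen uniformly at random (independently of the past); given $I_t=i,J_t=j$, an independent copy $S_t^{ij}$ of $S^{ij}$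 is sampled; and $X_{t+1}=X_t+K\{S_t^{ij}-b(X_t^i-X_t^j)\}(e_i-e_j)$. It has a unique stationary distribution on $\mathcal{Z}_N$, denoted $\pi$. *)

theory Defs
  imports "HOL-Probability.Probability"
begin

definition zero_sum :: "(real ^ 'n) set" where
  "zero_sum = {x. (\<Sum>i\<in>UNIV. x $ i) = 0}"

definition min_slope :: "(real \<Rightarrow> real) \<Rightarrow> real \<Rightarrow> real" where
  "min_slope b M = (INF (v, u)\<in>{(v, u). - M \<le> v \<and> v < u \<and> u \<le> M}. (b u - b v) / (u - v))"

definition elo_update ::
    "(real \<Rightarrow> real) \<Rightarrow> real \<Rightarrow> 'n \<Rightarrow> 'n \<Rightarrow> real \<Rightarrow> real ^ 'n \<Rightarrow> real ^ 'n" where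
  "elo_update b K i j s x =
     x + (K * (s - b (x $ i - x $ j))) *\<^sub>R (axis i 1 - axis j 1)"

text \<open>
  One-step transition law from \<open>x\<close>. The score is a fresh sample of \<open>S i j\<close>, so \<open>\<Omega>\<close> contributes
  only the marginal laws of its members.
\<close>

definition elo_kernel ::
    "'w measure \<Rightarrow> ('n \<Rightarrow> 'n \<Rightarrow> 'w \<Rightarrow> real) \<Rightarrow> (real \<Rightarrow> real) \<Rightarrow> real
      \<Rightarrow> real ^ 'n \<Rightarrow> (real ^ 'n) measure" where
  "elo_kernel \<Omega> S b K x =
     uniform_count_measure {(i, j). i \<noteq> j} \<bind>
       (\<lambda>(i, j). distr \<Omega> borel (\<lambda>\<omega>. elo_update b K i j (S i j \<omega>) x))"

text \<open>
  The state space \<open>Z\<close> is a subset of the ambient type; a measure on \<open>Z\<close> is represented as a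
  Borel measure on the ambient type that is concentrated on \<open>Z\<close>.
\<close>

definition stationary_on ::
    "'a::topological_space set \<Rightarrow> ('a \<Rightarrow> 'a measure) \<Rightarrow> 'a measure \<Rightarrow> bool" where
  "stationary_on Z \<kappa> \<pi> \<longleftrightarrow>
     prob_space \<pi> \<and> sets \<pi> = sets borel \<and> (AE x in \<pi>. x \<in> Z) \<and> \<pi> \<bind> \<kappa> = \<pi>"

definition measure_support :: "'a::topological_space measure \<Rightarrow> 'a set" where
  "measure_support \<mu> = {x. \<forall>U. open U \<and> x \<in> U \<longrightarrow> emeasure \<mu> U > 0}"

text \<open>
  The bind in \<open>stationary_on\<close> is only meaningful for a measurable kernel, such as:
\<close>

lemma measurable_elo_kernel:
  fixes S :: "'n::finite \<Rightarrow> 'n \<Rightarrow> 'w \<Rightarrow> real"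
  assumes "prob_space \<Omega>" "CARD('n) \<ge> 2" "continuous_on UNIV b"
    and S: "\<And>i j. i \<noteq> j \<Longrightarrow> S i j \<in> borel_measurable \<Omega>"
  shows "elo_kernel \<Omega> S b K \<in> borel \<rightarrow>\<^sub>M prob_algebra borel"
proof -
  let ?A = "{(i, j). i \<noteq> j} :: ('n \<times> 'n) set"
  let ?U = "uniform_count_measure ?A"
  have "\<exists>i j :: 'n. i \<noteq> j"
  proof (rule ccontr)
    assume "\<nexists>i j :: 'n. i \<noteq> j"
    then have "(UNIV :: 'n set) = {undefined}" by auto
    then have "CARD('n) = card {undefined :: 'n}" by (rule arg_cong)
    then show False using assms(2) by simp
  qed
  then have ne: "?A \<noteq> {}" by auto
  have U: "?U \<in> space (prob_algebra (count_space ?A))"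
    using prob_space_uniform_count_measure[OF _ ne]
    by (simp add: space_prob_algebra sets_uniform_count_measure)
  have \<Omega>: "\<Omega> \<in> space (prob_algebra \<Omega>)"
    using assms(1) by (simp add: space_prob_algebra)
  have b[measurable]: "b \<in> borel_measurable borel"
    using assms(3) by (rule borel_measurable_continuous_onI)
  have k: "(\<lambda>x. distr \<Omega> borel (\<lambda>\<omega>. elo_update b K i j (S i j \<omega>) x))
      \<in> borel \<rightarrow>\<^sub>M prob_algebra borel" if "i \<noteq> j" for i j
  proof (rule measurable_distr_prob_space2[where M = \<Omega>])
    show "(\<lambda>x. \<Omega>) \<in> borel \<rightarrow>\<^sub>M prob_algebra \<Omega>" using \<Omega> by simp
    note S[OF that, measurable]
    have [measurable]: "(\<lambda>x :: real ^ 'n. x $ l) \<in> borel_measurable borel" for l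
      by (intro borel_measurable_continuous_onI continuous_intros)
    have [measurable]: "(\<lambda>p :: (real ^ 'n) \<times> 'w. fst p $ l) \<in> borel_measurable (borel \<Otimes>\<^sub>M \<Omega>)" for l
      by measurable
    show "(\<lambda>(x, \<omega>). elo_update b K i j (S i j \<omega>) x) \<in> borel \<Otimes>\<^sub>M \<Omega> \<rightarrow>\<^sub>M borel"
      unfolding elo_update_def case_prod_beta'
      by (intro borel_measurable_add borel_measurable_scaleR borel_measurable_const) measurable
  qed
  have "(\<lambda>x. ?U \<bind> (\<lambda>p. distr \<Omega> borel
      (\<lambda>\<omega>. elo_update b K (fst p) (snd p) (S (fst p) (snd p) \<omega>) x)))
      \<in> borel \<rightarrow>\<^sub>M prob_algebra borel"
  proof (rule measurable_bind_prob_space2[where N = "count_space ?A"])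
    show "(\<lambda>x. ?U) \<in> borel \<rightarrow>\<^sub>M prob_algebra (count_space ?A)" using U by simp
    show "(\<lambda>(x, p). distr \<Omega> borel
        (\<lambda>\<omega>. elo_update b K (fst p) (snd p) (S (fst p) (snd p) \<omega>) x))
        \<in> borel \<Otimes>\<^sub>M count_space ?A \<rightarrow>\<^sub>M prob_algebra borel"
      unfolding case_prod_beta'
    proof (rule measurable_compose_countable'[where g = snd and I = "{p. fst p \<noteq> snd p}"
          and f = "\<lambda>p z. distr \<Omega> borel
            (\<lambda>\<omega>. elo_update b K (fst p) (snd p) (S (fst p) (snd p) \<omega>) (fst z))"])
      fix p :: "'n \<times> 'n" assume "p \<in> {p. fst p \<noteq> snd p}"
      then have "fst p \<noteq> snd p" by simp
      from measurable_compose[OF measurable_fst k[OF this]]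
      show "(\<lambda>z. distr \<Omega> borel
          (\<lambda>\<omega>. elo_update b K (fst p) (snd p) (S (fst p) (snd p) \<omega>) (fst z)))
          \<in> borel \<Otimes>\<^sub>M count_space {p. fst p \<noteq> snd p} \<rightarrow>\<^sub>M prob_algebra borel" .
    qed (auto intro: countable_finite)
  qed
  then show ?thesis
    by (simp add: elo_kernel_def[abs_def] case_prod_beta')
qed

end

theory Submission
  imports Defs
begin

text \<open>
  The support \<open>C\<close> of a stationary distribution is a nonempty closed set, and it is mapped into
  itself by each win map, the update \<open>F i j\<close> in which player \<open>i\<close> beats player \<open>j\<close> with the extreme
  score 1: scores arbitrarily close to 1 have positive probability, the update is jointly
  continuous in score and state, and by stationarity whatever the chain reaches in one step from
  near a support point has positive mass. Everything else is geometry: a nonempty closed subset of the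
  zero-sum hyperplane that is invariant under all win maps is the whole hyperplane.

  Two facts drive the geometric part. First, \<open>F i j\<close> is a Euclidean nonexpansion: it changes the
  difference of two states only along \<open>axis i 1 - axis j 1\<close>, where \<open>0 < K * L < 1\<close> and strict
  monotonicity of \<open>b\<close> make it strictly shrink any nonzero component (\<open>win_map_contracts\<close>). Hence
  the distance to \<open>C\<close> cannot decrease when one moves from a point to a preimage under a win map.
  Second, there are arbitrarily large compact sets, dilated permutohedra, in which one can move
  backwards forever using all pairs of players: for each pair, every point of the set has
  a preimage in the set under one of the two win maps (\<open>win_map_preimage_in_permutohedron\<close>).

  If \<open>C\<close> missed a point of the hyperplane, take a permutohedron containing it. The points of this
  compact set that maximise the distance to \<open>C\<close> can then be followed backwards through a word
  containing every pair, and the distance stays constant along the way. So no step strictly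
  shrinks the vector from the final point to a nearest point of \<open>C\<close>, which forces all its
  coordinates to coincide. A zero-sum vector with this property vanishes, but the distance was
  positive.
\<close>

section \<open>The win maps\<close>

text \<open>
  A win of \<open>j\<close> against \<open>i\<close> with score 1 is the same move as score -1 in the game of \<open>i\<close> against
  \<open>j\<close>, by oddness of \<open>b\<close>; ranging over ordered pairs, the score 1 covers both extreme outcomes.
\<close>

abbreviation win_map :: "(real \<Rightarrow> real) \<Rightarrow> real \<Rightarrow> 'n \<Rightarrow> 'n \<Rightarrow> real ^ 'n \<Rightarrow> real ^ 'n::finite" where
  "win_map b K i j \<equiv> elo_update b K i j 1"

lemma sum_elo_update:
  fixes x :: "real ^ 'n::finite"
  shows "(\<Sum>k\<in>A. elo_update b K i j s x $ k)
    = (\<Sum>k\<in>A. x $ k) + K * (s - b (x $ i - x $ j)) * (of_bool (i \<in> A) - of_bool (j \<in> A))"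
proof -
  have ax: "(\<Sum>k\<in>A. axis l (1::real) $ k) = of_bool (l \<in> A)" for l :: 'n
    by (simp add: axis_def of_bool_def)
  show ?thesis
    by (simp add: elo_update_def sum.distrib sum_subtractf ax flip: sum_distrib_left)
qed

lemma elo_update_diff_eq:
  fixes x z :: "real ^ 'n::finite"
  shows "elo_update b K i j s x - elo_update b K i j s z
    = x - z - (K * (b (x $ i - x $ j) - b (z $ i - z $ j))) *\<^sub>R (axis i 1 - axis j 1)"
  by (simp add: elo_update_def algebra_simps)

lemma win_map_contracts:
  fixes x z :: "real ^ 'n::finite"
  assumes "strict_mono b" "L-lipschitz_on UNIV b" "K > 0" "K * L < 1" "i \<noteq> j"
    and diff: "x $ i - x $ j \<noteq> z $ i - z $ j"
  shows "norm (win_map b K i j x - win_map b K i j z) < norm (x - z)"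
proof -
  define \<delta> where "\<delta> = x - z"
  define e where "e = axis i 1 - (axis j 1 :: real ^ 'n)"
  define \<beta> where "\<beta> = b (x $ i - x $ j) - b (z $ i - z $ j)"
  define t where "t = (x $ i - x $ j) - (z $ i - z $ j)"
  have "t \<noteq> 0" using diff by (simp add: t_def)
  have pos: "\<beta> * t > 0"
    using diff strict_mono_less[OF \<open>strict_mono b\<close>]
    by (cases "x $ i - x $ j < z $ i - z $ j")
      (auto simp: \<beta>_def t_def mult_neg_neg intro!: mult_neg_neg mult_pos_pos)
  have "\<bar>\<beta>\<bar> \<le> L * \<bar>t\<bar>"
    using lipschitz_onD[OF assms(2)] by (simp add: \<beta>_def t_def dist_real_def)
  then have "K * \<bar>\<beta>\<bar> \<le> K * L * \<bar>t\<bar>" using \<open>K > 0\<close> by simp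
  also have "\<dots> < \<bar>t\<bar>" using \<open>K * L < 1\<close> \<open>t \<noteq> 0\<close> by simp
  finally have "K * \<bar>\<beta>\<bar> < \<bar>t\<bar>" .
  moreover have "\<bar>\<beta>\<bar> > 0" using pos by auto
  ultimately have "\<bar>\<beta>\<bar> * (K * \<bar>\<beta>\<bar>) < \<bar>\<beta>\<bar> * \<bar>t\<bar>" by simp
  also have "\<bar>\<beta>\<bar> * \<bar>t\<bar> = \<beta> * t" using pos by (simp flip: abs_mult)
  finally have key: "K * \<beta>\<^sup>2 < \<beta> * t" by (simp add: power2_eq_square mult_ac)
  have ee: "e \<bullet> e = 2"
    using \<open>i \<noteq> j\<close> by (simp add: e_def inner_diff_left inner_diff_right inner_axis_axis)
  have de: "\<delta> \<bullet> e = t"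
    by (simp add: e_def \<delta>_def t_def inner_diff_right inner_axis)
  have "(norm (\<delta> - (K * \<beta>) *\<^sub>R e))\<^sup>2 = \<delta> \<bullet> \<delta> + 2 * K * (K * \<beta>\<^sup>2 - \<beta> * t)"
    using ee de unfolding power2_norm_eq_inner
    by (simp add: inner_diff_left inner_diff_right inner_commute[of e \<delta>] power2_eq_square
        algebra_simps)
  also have "\<dots> < \<delta> \<bullet> \<delta>" using key \<open>K > 0\<close> by (simp add: mult_pos_neg)
  finally have "norm (\<delta> - (K * \<beta>) *\<^sub>R e) < norm \<delta>"
    by (simp add: power2_norm_eq_inner[symmetric] power_less_imp_less_base)
  then show ?thesis by (simp add: elo_update_diff_eq \<delta>_def e_def \<beta>_def)
qed

lemma win_map_parallel:
  fixes x z :: "real ^ 'n::finite"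
  assumes "x $ i - x $ j = z $ i - z $ j"
  shows "win_map b K i j x - win_map b K i j z = x - z"
  using assms by (simp add: elo_update_diff_eq)

section \<open>Permutohedra and backward orbits\<close>

text \<open>
  For \<open>c > 0\<close> this is the permutohedron spanned by the permutations of
  \<open>c * (N-1, N-3, \<dots>, 1-N)\<close>: the bound for \<open>A\<close> is the sum of the \<open>card A\<close> largest of these
  numbers.
\<close>

definition permutohedron :: "real \<Rightarrow> (real ^ 'n::finite) set" where
  "permutohedron c = {x \<in> zero_sum.
     \<forall>A. (\<Sum>k\<in>A. x $ k) \<le> c * (real (card A) * (real CARD('n) - real (card A)))}"

lemma closed_zero_sum: "closed (zero_sum :: (real ^ 'n::finite) set)"
  unfolding zero_sum_def by (intro closed_Collect_eq continuous_intros)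

lemma compact_permutohedron: "compact (permutohedron c :: (real ^ 'n::finite) set)"
proof -
  have "closed (permutohedron c :: (real ^ 'n) set)"
    unfolding permutohedron_def Collect_conj_eq
    by (intro closed_Int closed_Collect_all closed_Collect_le continuous_intros)
      (simp add: closed_zero_sum)
  moreover have "bounded (permutohedron c :: (real ^ 'n) set)"
  proof -
    have "norm x \<le> (\<Sum>i\<in>(UNIV :: 'n set). c * (real CARD('n) - 1))"
      if "x \<in> permutohedron c" for x :: "real ^ 'n"
    proof -
      have bound: "(\<Sum>k\<in>A. x $ k) \<le> c * (real (card A) * (real CARD('n) - real (card A)))" for A
        using that by (simp add: permutohedron_def)
      have sum0: "(\<Sum>k\<in>UNIV. x $ k) = 0"
        using that by (simp add: permutohedron_def zero_sum_def)
      have "\<bar>x $ i\<bar> \<le> c * (real CARD('n) - 1)" for i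
      proof -
        have "(\<Sum>k\<in>UNIV - {i}. x $ k) = - x $ i"
          using sum0 by (simp add: sum_diff1)
        moreover have "real (card (UNIV - {i})) = real CARD('n) - 1"
          by (simp add: card_Diff_singleton of_nat_diff Suc_le_eq)
        ultimately show ?thesis
          using bound[of "{i}"] bound[of "UNIV - {i}"] by simp
      qed
      then have "(\<Sum>i\<in>UNIV. \<bar>x $ i\<bar>) \<le> (\<Sum>i\<in>(UNIV :: 'n set). c * (real CARD('n) - 1))"
        by (intro sum_mono)
      then show ?thesis
        using norm_le_l1_cart[of x] by linarith
    qed
    then show ?thesis unfolding bounded_iff by blast
  qed
  ultimately show ?thesis by (simp add: compact_eq_bounded_closed)
qed

lemma zero_sum_in_large_permutohedron:
  fixes x :: "real ^ 'n::finite"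
  assumes "x \<in> zero_sum" and c: "c \<ge> (\<Sum>k\<in>UNIV. \<bar>x $ k\<bar>)"
  shows "x \<in> permutohedron c"
proof -
  have c0: "c \<ge> 0" by (rule order_trans[OF _ c]) (simp add: sum_nonneg)
  have "(\<Sum>k\<in>A. x $ k) \<le> c * (real (card A) * (real CARD('n) - real (card A)))" for A :: "'n set"
  proof (cases "A = {} \<or> A = UNIV")
    case True
    then show ?thesis using assms(1) by (auto simp: zero_sum_def)
  next
    case False
    have "card A < CARD('n)" using False by (intro psubset_card_mono) auto
    moreover have "card A > 0" using False by (auto simp: card_gt_0_iff)
    ultimately have "1 * 1 \<le> real (card A) * (real CARD('n) - real (card A))"
      by (intro mult_mono) auto
    then have "c * 1 \<le> c * (real (card A) * (real CARD('n) - real (card A)))"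
      using c0 by (intro mult_left_mono) auto
    moreover have "(\<Sum>k\<in>A. x $ k) \<le> (\<Sum>k\<in>UNIV. \<bar>x $ k\<bar>)"
      by (rule order_trans[OF sum_mono[of A _ "\<lambda>k. \<bar>x $ k\<bar>"] sum_mono2]) auto
    ultimately show ?thesis using c by simp
  qed
  then show ?thesis using assms(1) by (simp add: permutohedron_def)
qed

text \<open>
  Undoing a win of the currently stronger player \<open>i\<close> moves rating from \<open>i\<close> to \<open>j\<close>. Only the sums
  over sets \<open>A\<close> that contain \<open>j\<close> but not \<open>i\<close> grow, and this cannot break their bounds: the
  difference \<open>x $ j - x $ i\<close> is at most \<open>4 * K\<close> afterwards, so the sum over \<open>A\<close> exceeds the average
  of the sums over \<open>insert i A\<close> and \<open>A - {j}\<close>, which are unchanged, by at most \<open>2 * K\<close>; the bound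
  is concave in the cardinality with second difference \<open>- 2 * c\<close>, which absorbs this.
\<close>

lemma win_map_preimage_in_permutohedron:
  fixes y :: "real ^ 'n::finite"
  assumes b: "\<And>u. -1 < b u \<and> b u < 1" and cont: "continuous_on UNIV b" and "K > 0"
    and "i \<noteq> j" and le: "y $ j \<le> y $ i" and "c \<ge> 2 * K" and y: "y \<in> permutohedron c"
  shows "\<exists>x \<in> permutohedron c. win_map b K i j x = y"
proof -
  have ij: "axis i (1::real) $ j = 0" "axis j (1::real) $ i = 0"
    using \<open>i \<noteq> j\<close> by (auto simp: axis_def)
  define d where "d = y $ i - y $ j"
  \<comment> \<open>A win turns the difference \<open>u\<close> of the two ratings into \<open>\<phi> u\<close>, a gain between 0 and \<open>4 * K\<close>.\<close>
  define \<phi> where "\<phi> = (\<lambda>u. u + 2 * K * (1 - b u))"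
  have "\<exists>u. d - 4 * K \<le> u \<and> u \<le> d \<and> \<phi> u = d"
  proof (rule IVT')
    have "K * (2 * (1 - b (d - 4 * K))) \<le> K * 4"
      using b[of "d - 4 * K"] \<open>K > 0\<close> by (intro mult_left_mono) auto
    then show "\<phi> (d - 4 * K) \<le> d" by (simp add: \<phi>_def algebra_simps)
    have "0 \<le> K * (1 - b d)" using b[of d] \<open>K > 0\<close> by simp
    then show "d \<le> \<phi> d" by (simp add: \<phi>_def)
    show "d - 4 * K \<le> d" using \<open>K > 0\<close> by simp
    show "continuous_on {d - 4 * K..d} \<phi>"
      unfolding \<phi>_def by (intro continuous_intros continuous_on_subset[OF cont]) auto
  qed
  then obtain u where u: "d - 4 * K \<le> u" "\<phi> u = d" by blast
  define h where "h = K * (1 - b u)"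
  have "h \<ge> 0" using b[of u] \<open>K > 0\<close> by (simp add: h_def)
  define x where "x = y - h *\<^sub>R (axis i 1 - axis j 1)"
  have xu: "x $ i - x $ j = u"
    using u(2) ij by (simp add: x_def d_def \<phi>_def h_def algebra_simps)
  have img: "win_map b K i j x = y"
    unfolding elo_update_def xu by (simp add: x_def h_def)
  have sum_y: "(\<Sum>k\<in>A. y $ k) = (\<Sum>k\<in>A. x $ k) + h * (of_bool (i \<in> A) - of_bool (j \<in> A))" for A
    using sum_elo_update[of b K i j 1 x A] by (simp add: img xu h_def)
  have bound: "(\<Sum>k\<in>A. y $ k) \<le> c * (real (card A) * (real CARD('n) - real (card A)))" for A
    using y by (simp add: permutohedron_def)
  have "(\<Sum>k\<in>A. x $ k) \<le> c * (real (card A) * (real CARD('n) - real (card A)))" for A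
  proof (cases "j \<in> A \<and> i \<notin> A")
    case False
    then have "h * (of_bool (i \<in> A) - of_bool (j \<in> A)) \<ge> 0" using \<open>h \<ge> 0\<close> by auto
    then show ?thesis using sum_y[of A] bound[of A] by linarith
  next
    case True
    define m where "m = real (card A)"
    have ci: "real (card (insert i A)) = m + 1" using True by (simp add: m_def)
    have "card A > 0" using True by (auto simp: card_gt_0_iff)
    then have cj: "real (card (A - {j})) = m - 1"
      using True by (simp add: m_def card_Diff_singleton of_nat_diff Suc_le_eq)
    have "(\<Sum>k\<in>insert i A. x $ k) \<le> c * ((m + 1) * (real CARD('n) - (m + 1)))"
      using bound[of "insert i A"] sum_y[of "insert i A"] True by (simp only: ci) auto
    then have 1: "x $ i + (\<Sum>k\<in>A. x $ k) \<le> c * ((m + 1) * (real CARD('n) - (m + 1)))"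
      using True by simp
    have "(\<Sum>k\<in>A - {j}. x $ k) \<le> c * ((m - 1) * (real CARD('n) - (m - 1)))"
      using bound[of "A - {j}"] sum_y[of "A - {j}"] True \<open>i \<noteq> j\<close> by (simp only: cj) auto
    then have 2: "(\<Sum>k\<in>A. x $ k) - x $ j \<le> c * ((m - 1) * (real CARD('n) - (m - 1)))"
      using True by (simp add: sum_diff1)
    have 3: "x $ j - x $ i \<le> 2 * c"
      using xu u(1) le \<open>c \<ge> 2 * K\<close> by (simp add: d_def)
    have "c * ((m + 1) * (real CARD('n) - (m + 1))) + c * ((m - 1) * (real CARD('n) - (m - 1)))
        = 2 * (c * (m * (real CARD('n) - m))) - 2 * c"
      by (simp add: algebra_simps)
    then show ?thesis using 1 2 3 unfolding m_def[symmetric] by linarith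
  qed
  moreover have "x \<in> zero_sum"
    using y sum_y[of UNIV] by (simp add: zero_sum_def permutohedron_def)
  ultimately show ?thesis using img by (auto simp: permutohedron_def)
qed

section \<open>Closed sets invariant under the win maps\<close>

text \<open>
  The distance to \<open>C\<close> is constant along a backward orbit inside \<open>T\<close>, its set of maximisers on a
  permutohedron. Along such an orbit the vector to a nearest point of \<open>C\<close> is merely transported,
  so every pair played so far forces two of its coordinates to agree.
\<close>

theorem closed_invariant_eq_zero_sum:
  fixes C :: "(real ^ 'n::finite) set"
  assumes b: "\<And>u. -1 < b u \<and> b u < 1" and mono: "strict_mono b" and lip: "L-lipschitz_on UNIV b"
    and "K > 0" "K * L < 1"
    and "closed C" "C \<noteq> {}" "C \<subseteq> zero_sum"
    and inv: "\<And>i j x. i \<noteq> j \<Longrightarrow> x \<in> C \<Longrightarrow> win_map b K i j x \<in> C"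
  shows "C = zero_sum"
proof (rule ccontr)
  assume "C \<noteq> zero_sum"
  then obtain y0 where y0: "y0 \<in> zero_sum" "y0 \<notin> C" using \<open>C \<subseteq> zero_sum\<close> by blast
  define c where "c = max (2 * K) (\<Sum>k\<in>UNIV. \<bar>y0 $ k\<bar>)"
  let ?D = "permutohedron c :: (real ^ 'n) set"
  have "y0 \<in> ?D" using zero_sum_in_large_permutohedron[OF y0(1)] by (simp add: c_def)
  then have "\<exists>y\<in>?D. \<forall>x\<in>?D. infdist x C \<le> infdist y C"
    by (intro continuous_attains_sup compact_permutohedron continuous_intros) auto
  then obtain y1 where y1: "y1 \<in> ?D" and max: "\<And>x. x \<in> ?D \<Longrightarrow> infdist x C \<le> infdist y1 C"
    by blast
  define G where "G = infdist y1 C"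
  have "infdist y0 C > 0"
    using y0 \<open>closed C\<close> \<open>C \<noteq> {}\<close> by (simp add: infdist_pos_not_in_closed)
  then have "G > 0" using max[OF \<open>y0 \<in> ?D\<close>] by (simp add: G_def)
  define T where "T = {x \<in> ?D. infdist x C = G}"
  have nearest: "\<exists>z\<in>C. infdist x C = norm (x - z)" for x
    using infdist_attains_inf[OF \<open>closed C\<close> \<open>C \<noteq> {}\<close>, of x] by (auto simp: dist_norm)
  have shrink: "norm (win_map b K i j x - win_map b K i j z) < norm (x - z)"
    if "i \<noteq> j" "x $ i - x $ j \<noteq> z $ i - z $ j" for i j and x z :: "real ^ 'n"
    using win_map_contracts[OF mono lip \<open>K > 0\<close> \<open>K * L < 1\<close> that] .
  have mono_dist: "infdist (win_map b K i j x) C \<le> infdist x C" if "i \<noteq> j" for i j x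
  proof -
    obtain z where z: "z \<in> C" "infdist x C = norm (x - z)" using nearest by blast
    have "infdist (win_map b K i j x) C \<le> norm (win_map b K i j x - win_map b K i j z)"
      using infdist_le[OF inv[OF that z(1)]] by (simp add: dist_norm)
    also have "\<dots> \<le> norm (x - z)"
      using shrink[OF that, of x z] win_map_parallel[of x i j z b K] by force
    finally show ?thesis using z(2) by simp
  qed
  have backward: "\<exists>x\<in>T. win_map b K i j x = y" if y: "y \<in> T" and ij: "i \<noteq> j" "y $ j \<le> y $ i" for y i j
  proof -
    have "y \<in> ?D" using y by (simp add: T_def)
    then obtain x where x: "x \<in> ?D" "win_map b K i j x = y"
      using win_map_preimage_in_permutohedron[OF b lipschitz_on_continuous_on[OF lip] \<open>K > 0\<close>
          ij, of c]
      by (auto simp: c_def)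
    have "infdist x C = G"
      using mono_dist[OF ij(1), of x] max[OF x(1)] x(2) y by (simp add: T_def G_def)
    then show ?thesis using x by (auto simp: T_def)
  qed
  have level: "\<exists>x\<in>T. \<forall>z\<in>C. norm (x - z) = G \<longrightarrow>
      (\<forall>i j. (i, j) \<in> P \<longrightarrow> i \<noteq> j \<longrightarrow> (x - z) $ i = (x - z) $ j)"
    if "finite P" for P :: "('n \<times> 'n) set"
    using that
  proof (induction P)
    case empty
    show ?case using y1 by (auto simp: T_def G_def)
  next
    case (insert p P)
    then obtain y where y: "y \<in> T" and IH: "\<forall>z\<in>C. norm (y - z) = G \<longrightarrow>
        (\<forall>i j. (i, j) \<in> P \<longrightarrow> i \<noteq> j \<longrightarrow> (y - z) $ i = (y - z) $ j)"
      by (elim bexE)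
    obtain i j where p: "p = (i, j)" by fastforce
    show ?case
    proof (cases "i = j")
      case True
      then show ?thesis using y IH p by (intro bexI[OF _ y]) auto
    next
      case False
      \<comment> \<open>Only a win of the player who is ahead in \<open>y\<close> can be undone within the permutohedron;
        this may be \<open>j\<close>, but the conclusion is symmetric in the pair.\<close>
      obtain k l where kl: "{k, l} = {i, j}" "k \<noteq> l" "y $ l \<le> y $ k"
      proof (cases "y $ j \<le> y $ i")
        case True
        then show ?thesis using that[of i j] False by simp
      next
        case swapped: False
        then show ?thesis using that[of j i] False by (simp add: insert_commute)
      qed
      obtain x where x: "x \<in> T" "win_map b K k l x = y" using backward[OF y kl(2,3)] by blast
      have par: "x $ k - x $ l = z $ k - z $ l \<and> y - win_map b K k l z = x - z"
        if z: "z \<in> C" "norm (x - z) = G" for z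
      proof -
        have "G \<le> norm (win_map b K k l x - win_map b K k l z)"
          using infdist_le[OF inv[OF kl(2) z(1)], of y] y x(2) by (simp add: T_def dist_norm)
        then have "x $ k - x $ l = z $ k - z $ l" using shrink[OF kl(2), of x z] z(2) by fastforce
        then show ?thesis using win_map_parallel[of x k l z b K] x(2) by simp
      qed
      have "(x - z) $ i' = (x - z) $ j'"
        if z: "z \<in> C" "norm (x - z) = G" and "(i', j') \<in> insert p P" "i' \<noteq> j'" for z i' j'
      proof (cases "(i', j') = p")
        case True
        then have "(i' = k \<and> j' = l) \<or> (i' = l \<and> j' = k)"
          using p kl(1) by (auto simp: doubleton_eq_iff)
        then show ?thesis using par[OF z] by auto
      next
        case notp: False
        then show ?thesis
          using IH[rule_format, OF inv[OF kl(2) z(1)], of i' j'] par[OF z] z(2) that(3,4) by simp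
      qed
      then show ?thesis using x(1) by (intro bexI[OF _ x(1)]) auto
    qed
  qed
  obtain x where x: "x \<in> T" and const: "\<forall>z\<in>C. norm (x - z) = G \<longrightarrow>
      (\<forall>i j. i \<noteq> j \<longrightarrow> (x - z) $ i = (x - z) $ j)"
    using level[of UNIV] by auto
  obtain z where z: "z \<in> C" "norm (x - z) = G" using nearest[of x] x by (auto simp: T_def)
  have "x \<in> zero_sum" using x by (simp add: T_def permutohedron_def)
  then have "(\<Sum>k\<in>UNIV. (x - z) $ k) = 0"
    using z(1) \<open>C \<subseteq> zero_sum\<close> by (auto simp: zero_sum_def sum_subtractf)
  moreover have "(\<Sum>k\<in>UNIV. (x - z) $ k) = real CARD('n) * (x - z) $ i" for i
  proof -
    have "(x - z) $ k = (x - z) $ i" for k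
      using const[rule_format, OF z, of k i] by (cases "k = i") auto
    then have "(\<Sum>k\<in>UNIV. (x - z) $ k) = (\<Sum>k\<in>(UNIV :: 'n set). (x - z) $ i)"
      by (rule sum.cong[OF refl])
    then show ?thesis by simp
  qed
  ultimately have "x - z = 0" by (simp add: vec_eq_iff)
  then show False using z(2) \<open>G > 0\<close> by simp
qed

section \<open>Supports of stationary distributions\<close>

lemma closed_measure_support: "closed (measure_support \<mu>)"
  unfolding closed_def
proof (subst open_subopen, intro ballI)
  fix x assume "x \<in> - measure_support \<mu>"
  then obtain U where U: "open U" "x \<in> U" "\<not> emeasure \<mu> U > 0"
    by (auto simp: measure_support_def)
  then have "U \<subseteq> - measure_support \<mu>" by (auto simp: measure_support_def)
  then show "\<exists>T. open T \<and> x \<in> T \<and> T \<subseteq> - measure_support \<mu>" using U by blast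
qed

text \<open>
  By second countability, the uncountable union of all open null sets is already the union of
  countably many of them.
\<close>

lemma AE_in_measure_support:
  fixes \<mu> :: "'a::second_countable_topology measure"
  assumes sets: "sets \<mu> = sets borel"
  shows "AE x in \<mu>. x \<in> measure_support \<mu>"
proof -
  define F where "F = {U. open U \<and> emeasure \<mu> U = 0}"
  obtain F' where F': "F' \<subseteq> F" "countable F'" "\<Union>F' = \<Union>F"
    using Lindelof[of F] by (auto simp: F_def)
  have "(\<Union>U\<in>F'. U) \<in> null_sets \<mu>"
    by (rule null_sets_UN'[OF F'(2)]) (use F'(1) sets in \<open>auto simp: F_def null_sets_def\<close>)
  then have "\<Union>F' \<in> null_sets \<mu>" by simp
  moreover have "- measure_support \<mu> \<subseteq> \<Union>F'"
    unfolding F'(3) by (auto simp: measure_support_def F_def)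
  ultimately show ?thesis by (intro AE_I'[of "\<Union>F'"]) auto
qed

lemma measure_support_subset_closed:
  assumes "sets \<mu> = sets borel" "closed Z" "AE x in \<mu>. x \<in> Z"
  shows "measure_support \<mu> \<subseteq> Z"
proof
  fix x assume x: "x \<in> measure_support \<mu>"
  have "emeasure \<mu> (- Z) = 0"
    using assms by (subst (asm) AE_iff_measurable[of "- Z"])
      (auto simp: sets_eq_imp_space_eq[OF assms(1)])
  then show "x \<in> Z" using x \<open>closed Z\<close> by (auto simp: measure_support_def open_Compl)
qed

lemma elo_kernel_pos:
  fixes S :: "'n::finite \<Rightarrow> 'n \<Rightarrow> 'w \<Rightarrow> real"
  assumes "prob_space \<Omega>" and S: "\<And>i j. i \<noteq> j \<Longrightarrow> S i j \<in> borel_measurable \<Omega>"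
    and "i \<noteq> j" "open U"
    and pos: "emeasure \<Omega> {\<omega> \<in> space \<Omega>. elo_update b K i j (S i j \<omega>) x \<in> U} > 0"
  shows "emeasure (elo_kernel \<Omega> S b K x) U > 0"
proof -
  let ?A = "{(i, j). i \<noteq> j} :: ('n \<times> 'n) set"
  let ?f = "\<lambda>(i, j). distr \<Omega> borel (\<lambda>\<omega>. elo_update b K i j (S i j \<omega>) x)"
  have meas: "(\<lambda>\<omega>. elo_update b K i j (S i j \<omega>) x) \<in> borel_measurable \<Omega>" if "i \<noteq> j" for i j
    using S[OF that] unfolding elo_update_def by measurable
  have ij: "(i, j) \<in> ?A" using \<open>i \<noteq> j\<close> by simp
  have "?f p \<in> space (subprob_algebra borel)" if "p \<in> ?A" for p
    using that meas
    by (auto simp: space_subprob_algebra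
        intro!: prob_space_imp_subprob_space prob_space.prob_space_distr[OF \<open>prob_space \<Omega>\<close>])
  then have "?f \<in> uniform_count_measure ?A \<rightarrow>\<^sub>M subprob_algebra borel"
    by (auto simp: measurable_def space_uniform_count_measure sets_uniform_count_measure)
  then have "emeasure (elo_kernel \<Omega> S b K x) U
      = (\<integral>\<^sup>+p. emeasure (?f p) U \<partial>uniform_count_measure ?A)"
    unfolding elo_kernel_def using ij \<open>open U\<close>
    by (intro emeasure_bind) (auto simp: space_uniform_count_measure)
  also have "\<dots> \<noteq> 0"
  proof
    assume "(\<integral>\<^sup>+p. emeasure (?f p) U \<partial>uniform_count_measure ?A) = 0"
    then have "AE p in uniform_count_measure ?A. emeasure (?f p) U = 0"
      by (subst (asm) nn_integral_0_iff_AE) (auto simp: measurable_def sets_uniform_count_measure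
          space_uniform_count_measure)
    then have "\<forall>p\<in>?A. 0 < ennreal (1 / real (card ?A)) \<longrightarrow> emeasure (?f p) U = 0"
      unfolding uniform_count_measure_def AE_point_measure .
    moreover have "card ?A > 0" using ij by (auto simp: card_gt_0_iff)
    ultimately have "emeasure (?f (i, j)) U = 0" using ij by auto
    moreover have "emeasure (?f (i, j)) U
        = emeasure \<Omega> {\<omega> \<in> space \<Omega>. elo_update b K i j (S i j \<omega>) x \<in> U}"
      using meas[OF \<open>i \<noteq> j\<close>] \<open>open U\<close>
      by (auto simp: emeasure_distr vimage_def Int_def conj_commute)
    ultimately show False using pos by simp
  qed
  finally show ?thesis by (simp add: zero_less_iff_neq_zero)
qed

text \<open>
  Near a support point \<open>x\<close>, and for scores near 1, the update lands near \<open>win_map b K i j x\<close>; both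
  closeness conditions have positive probability, so one step of the stationary chain does, too.
\<close>

lemma win_map_preserves_support:
  fixes S :: "'n::finite \<Rightarrow> 'n \<Rightarrow> 'w \<Rightarrow> real" and \<pi> :: "(real ^ 'n) measure"
  assumes "CARD('n) \<ge> 2" and \<Omega>: "prob_space \<Omega>" and cont: "continuous_on UNIV b"
    and S: "\<And>i j. i \<noteq> j \<Longrightarrow> S i j \<in> borel_measurable \<Omega>"
    and le1: "\<And>\<omega>. \<omega> \<in> space \<Omega> \<Longrightarrow> S i j \<omega> \<le> 1"
    and pos: "\<And>\<epsilon>. \<epsilon> > 0 \<Longrightarrow> measure \<Omega> {\<omega> \<in> space \<Omega>. S i j \<omega> > 1 - \<epsilon>} > 0"
    and sets: "sets \<pi> = sets borel" and stat: "\<pi> \<bind> elo_kernel \<Omega> S b K = \<pi>"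
    and "i \<noteq> j" and x: "x \<in> measure_support \<pi>"
  shows "win_map b K i j x \<in> measure_support \<pi>"
  unfolding measure_support_def
proof (intro CollectI allI impI)
  fix U assume U: "open U \<and> win_map b K i j x \<in> U"
  let ?\<kappa> = "elo_kernel \<Omega> S b K"
  have "continuous_on UNIV (\<lambda>p :: real \<times> (real ^ 'n). elo_update b K i j (fst p) (snd p))"
    unfolding elo_update_def
    by (intro continuous_intros continuous_on_compose2[OF cont]) auto
  then have "open ((\<lambda>p. elo_update b K i j (fst p) (snd p)) -` U)"
    using U by (intro open_vimage) auto
  moreover have "(1, x) \<in> (\<lambda>p. elo_update b K i j (fst p) (snd p)) -` U" using U by simp
  ultimately obtain W V where WV: "open W" "open V" "1 \<in> W" "x \<in> V"
      "W \<times> V \<subseteq> (\<lambda>p. elo_update b K i j (fst p) (snd p)) -` U"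
    by (auto elim!: open_prod_elim)
  obtain \<epsilon> where \<epsilon>: "\<epsilon> > 0" "ball 1 \<epsilon> \<subseteq> W" using WV(1,3) open_contains_ball by blast
  have \<kappa>pos: "emeasure (?\<kappa> v) U > 0" if v: "v \<in> V" for v
  proof (rule elo_kernel_pos[OF \<Omega> S \<open>i \<noteq> j\<close>])
    have "emeasure \<Omega> {\<omega> \<in> space \<Omega>. S i j \<omega> > 1 - \<epsilon>} > 0"
      using pos[OF \<epsilon>(1)] unfolding measure_def by (metis enn2real_0 less_irrefl zero_less_iff_neq_zero)
    also have "\<dots> \<le> emeasure \<Omega> {\<omega> \<in> space \<Omega>. elo_update b K i j (S i j \<omega>) v \<in> U}"
    proof (rule emeasure_mono)
      show "{\<omega> \<in> space \<Omega>. S i j \<omega> > 1 - \<epsilon>} \<subseteq> {\<omega> \<in> space \<Omega>. elo_update b K i j (S i j \<omega>) v \<in> U}"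
      proof safe
        fix \<omega> assume "\<omega> \<in> space \<Omega>" "1 - \<epsilon> < S i j \<omega>"
        then have "S i j \<omega> \<in> W" using le1[of \<omega>] \<epsilon>(2) by (auto simp: dist_real_def)
        then show "elo_update b K i j (S i j \<omega>) v \<in> U" using WV(5) v by auto
      qed
      have "(\<lambda>\<omega>. elo_update b K i j (S i j \<omega>) v) \<in> borel_measurable \<Omega>"
        using S[OF \<open>i \<noteq> j\<close>] unfolding elo_update_def by measurable
      then show "{\<omega> \<in> space \<Omega>. elo_update b K i j (S i j \<omega>) v \<in> U} \<in> sets \<Omega>"
        by (rule measurable_sets_Collect) (use U in simp)
    qed
    finally show "emeasure \<Omega> {\<omega> \<in> space \<Omega>. elo_update b K i j (S i j \<omega>) v \<in> U} > 0" .
  qed (use U in auto)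
  have "?\<kappa> \<in> borel \<rightarrow>\<^sub>M subprob_algebra borel"
    by (intro measurable_prob_algebraD measurable_elo_kernel[OF \<Omega> assms(1) cont S])
  then have \<kappa>: "?\<kappa> \<in> \<pi> \<rightarrow>\<^sub>M subprob_algebra borel"
    by (simp cong: measurable_cong_sets add: sets)
  have sU: "U \<in> sets borel" using U by simp
  have "emeasure \<pi> U = (\<integral>\<^sup>+v. emeasure (?\<kappa> v) U \<partial>\<pi>)"
    using emeasure_bind[OF _ \<kappa> sU] sets_eq_imp_space_eq[OF sets] stat by simp
  also have "\<dots> \<noteq> 0"
  proof
    assume "(\<integral>\<^sup>+v. emeasure (?\<kappa> v) U \<partial>\<pi>) = 0"
    moreover have "(\<lambda>v. emeasure (?\<kappa> v) U) \<in> borel_measurable \<pi>"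
      using measurable_emeasure_kernel[OF \<kappa> sU] .
    ultimately have "AE v in \<pi>. emeasure (?\<kappa> v) U = 0" by (simp add: nn_integral_0_iff_AE)
    then have "AE v in \<pi>. v \<in> - V" by eventually_elim (use \<kappa>pos in fastforce)
    then have "measure_support \<pi> \<subseteq> - V"
      using measure_support_subset_closed[OF sets] WV(2) by (simp add: closed_Compl)
    then show False using x WV(4) by blast
  qed
  finally show "emeasure \<pi> U > 0" by (simp add: zero_less_iff_neq_zero)
qed

theorem theorem26:
  fixes \<rho> :: "real ^ 'n"
    and b :: "real \<Rightarrow> real"
    and L K :: real
    and \<Omega> :: "'w measure"
    and S :: "'n \<Rightarrow> 'n \<Rightarrow> 'w \<Rightarrow> real"
    and \<pi> :: "(real ^ 'n) measure"
  assumes "CARD('n) \<ge> 2"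
    and "\<rho> \<in> zero_sum"
    and "\<And>u. -1 < b u \<and> b u < 1"
    and "\<And>u. b (- u) = - b u"
    and "strict_mono b"
    and "L-lipschitz_on UNIV b"
    and "\<And>M. M > 0 \<Longrightarrow> min_slope b M > 0"
    and "prob_space \<Omega>"
    and "\<And>i j. i \<noteq> j \<Longrightarrow> S i j \<in> borel_measurable \<Omega>"
    and "\<And>i j \<omega>. i \<noteq> j \<Longrightarrow> \<omega> \<in> space \<Omega> \<Longrightarrow> S i j \<omega> \<in> {-1..1}"
    and "\<And>i j. i \<noteq> j \<Longrightarrow> (\<integral>\<omega>. S i j \<omega> \<partial>\<Omega>) = b (\<rho> $ i - \<rho> $ j)"
    and "\<And>i j \<omega>. i \<noteq> j \<Longrightarrow> \<omega> \<in> space \<Omega> \<Longrightarrow> S j i \<omega> = - S i j \<omega>"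
    and "K > 0"
    and "K * L < 1"
    and "\<And>i j \<epsilon>. i \<noteq> j \<Longrightarrow> \<epsilon> > 0 \<Longrightarrow> measure \<Omega> {\<omega> \<in> space \<Omega>. S i j \<omega> < -1 + \<epsilon>} > 0"
    and "\<And>i j \<epsilon>. i \<noteq> j \<Longrightarrow> \<epsilon> > 0 \<Longrightarrow> measure \<Omega> {\<omega> \<in> space \<Omega>. S i j \<omega> > 1 - \<epsilon>} > 0"
    and "stationary_on zero_sum (elo_kernel \<Omega> S b K) \<pi>"
  shows "measure_support \<pi> = zero_sum"
proof (rule closed_invariant_eq_zero_sum[OF assms(3) assms(5,6) assms(13,14)])
  have \<pi>: "prob_space \<pi>" "sets \<pi> = sets borel" "AE x in \<pi>. x \<in> zero_sum"
      "\<pi> \<bind> elo_kernel \<Omega> S b K = \<pi>"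
    using assms(17) by (auto simp: stationary_on_def)
  show "closed (measure_support \<pi>)" by (rule closed_measure_support)
  show "measure_support \<pi> \<subseteq> zero_sum"
    by (rule measure_support_subset_closed[OF \<pi>(2) closed_zero_sum \<pi>(3)])
  show "measure_support \<pi> \<noteq> {}"
  proof
    assume "measure_support \<pi> = {}"
    then have "AE x in \<pi>. False" using AE_in_measure_support[OF \<pi>(2)] by simp
    then show False using prob_space.AE_False[OF \<pi>(1)] by simp
  qed
  show "win_map b K i j x \<in> measure_support \<pi>" if "i \<noteq> j" "x \<in> measure_support \<pi>" for i j x
  proof (rule win_map_preserves_support[where S = S and \<Omega> = \<Omega>])
    show "S i j \<omega> \<le> 1" if "\<omega> \<in> space \<Omega>" for \<omega>
      using assms(10)[OF \<open>i \<noteq> j\<close> that] by simp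
    show "measure \<Omega> {\<omega> \<in> space \<Omega>. S i j \<omega> > 1 - \<epsilon>} > 0" if "\<epsilon> > 0" for \<epsilon>
      using assms(16)[OF \<open>i \<noteq> j\<close> that] .
  qed (use that \<pi> assms(1,8,9) lipschitz_on_continuous_on[OF assms(6)] in auto)
qed

end
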